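(* The length $L(n)$ of the Namer--Claimer game on $[n]$, with optimal play from both sides, is $\Theta(\log\log n)$ as $n\to\infty$. That is, there exist constants $c,C>0$ and $n_0$ such that $c\log\log n\le L(n)\le C\log\log n$ for all $n\ge n_0$.
   Context: Write $[n]=\{1,\ldots,n\}$. The Namer--Claimer game on $[n]$ ($n\ge 2$) is played as follows. Set $A_0=[n]$ (the unclaimed points). In round $i=1,2,\ldots$, Namer names a distance $d_i\in[n-1]$ (repetitions of earlier distances are allowed); then, knowing $d_i$, Claimer selects a set $C_i\subseteq A_{i-1}$ that is $d_i$-free, i.e. contains no two points $x,y$ with $|x-y|=d_i$; set $A_i=A_{i-1}\setminus C_i$. If $A_i=\emptyset$ the game ends and Claimer has won (in $i$ rounds); otherwise play continues to round $i+1$. Both players have full information about all previous moves. Claimer aims to minimise the number of rounds and Namer aims to maximise it. The length $L(n)$ of the game with optimal play is the least $k$ such that Claimer has a strategy guaranteeing that the game ends in at most $k$ rounds, whatever Namer does. *)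

theory Defs
  imports Complex_Main
begin

text \<open>
  A history lists the rounds played so far, most recent round first; a round is a pair
  \<open>(d, C)\<close> of the distance named and the set claimed.
\<close>

type_synonym history = "(nat \<times> nat set) list"

definition dist_free :: "nat \<Rightarrow> nat set \<Rightarrow> bool" where
  "dist_free d C \<longleftrightarrow> (\<forall>x\<in>C. \<forall>y\<in>C. \<bar>int x - int y\<bar> \<noteq> int d)"

definition unclaimed :: "nat \<Rightarrow> history \<Rightarrow> nat set" where
  "unclaimed n h = {1..n} - (\<Union>(d, C)\<in>set h. C)"

definition namer_strategy :: "nat \<Rightarrow> (history \<Rightarrow> nat) \<Rightarrow> bool" where
  "namer_strategy n \<tau> \<longleftrightarrow> (\<forall>h. \<tau> h \<in> {1..n - 1})"

text \<open>
  Legality is required at every history, reachable or not. This costs Claimer nothing, since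
  the empty set is always a legal claim.
\<close>

definition claimer_strategy :: "nat \<Rightarrow> (history \<Rightarrow> nat \<Rightarrow> nat set) \<Rightarrow> bool" where
  "claimer_strategy n \<sigma> \<longleftrightarrow>
     (\<forall>h. \<forall>d\<in>{1..n - 1}. \<sigma> h d \<subseteq> unclaimed n h \<and> dist_free d (\<sigma> h d))"

text \<open>
  The play is continued formally after all points have been claimed; from then on Claimer can
  only claim the empty set.
\<close>

primrec play :: "(history \<Rightarrow> nat \<Rightarrow> nat set) \<Rightarrow> (history \<Rightarrow> nat) \<Rightarrow> nat \<Rightarrow> history" where
  "play \<sigma> \<tau> 0 = []"
| "play \<sigma> \<tau> (Suc i) =
     (let h = play \<sigma> \<tau> i; d = \<tau> h in (d, \<sigma> h d) # h)"

definition claimer_can_win_within :: "nat \<Rightarrow> nat \<Rightarrow> bool" where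
  "claimer_can_win_within n k \<longleftrightarrow>
     (\<exists>\<sigma>. claimer_strategy n \<sigma> \<and>
        (\<forall>\<tau>. namer_strategy n \<tau> \<longrightarrow> (\<exists>i\<le>k. unclaimed n (play \<sigma> \<tau> i) = {})))"

definition game_length :: "nat \<Rightarrow> nat" where
  "game_length n = (LEAST k. claimer_can_win_within n k)"

text \<open>
  The minimum defining \<open>game_length\<close> is attained: claiming one point per round finishes
  the game in \<open>n\<close> rounds.
\<close>

lemma claimer_can_win_within_n: "claimer_can_win_within n n"
proof -
  define \<sigma> :: "history \<Rightarrow> nat \<Rightarrow> nat set" where
    "\<sigma> = (\<lambda>h d. if unclaimed n h = {} then {} else {Min (unclaimed n h)})"
  have fin: "finite (unclaimed n h)" for h
    by (simp add: unclaimed_def)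
  have "claimer_strategy n \<sigma>"
    using fin by (auto simp: claimer_strategy_def \<sigma>_def dist_free_def Min_in)
  moreover have "card (unclaimed n (play \<sigma> \<tau> i)) \<le> n - i" for \<tau> i
  proof (induction i)
    case 0
    show ?case by (simp add: unclaimed_def)
  next
    case (Suc i)
    let ?h = "play \<sigma> \<tau> i"
    have step: "unclaimed n (play \<sigma> \<tau> (Suc i)) = unclaimed n ?h - \<sigma> ?h (\<tau> ?h)"
      by (auto simp: unclaimed_def Let_def)
    show ?case
    proof (cases "unclaimed n ?h = {}")
      case True
      then show ?thesis by (simp only: step) simp
    next
      case False
      then have "card (unclaimed n (play \<sigma> \<tau> (Suc i))) = card (unclaimed n ?h) - 1"
        using fin by (simp only: step) (simp add: \<sigma>_def card_Diff_singleton)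
      then show ?thesis using Suc.IH by linarith
    qed
  qed
  then have "unclaimed n (play \<sigma> \<tau> n) = {}" for \<tau>
    using fin by (metis card_0_eq diff_self_eq_0 le_zero_eq)
  ultimately show ?thesis
    unfolding claimer_can_win_within_def by blast
qed

end

theory Submission
  imports Defs
begin

text \<open>
  Lower bound: Namer names the most frequent difference of the unclaimed set \<open>A\<close>. The points
  left by Claimer cover all pairs at that distance, so at least \<open>\<bar>A\<bar>\<^sup>2 / (8 n)\<close> of them
  survive, and the exponent of the density at most doubles in each round.

  Upper bound: take \<open>2 ^ k\<close> at least \<open>log\<^sub>2 n\<close>. Consider all sets of \<open>2 ^ k\<close> points which are
  connected in the graph of some \<open>k\<close> distances; there are only \<open>exp (O(k 2 ^ k))\<close> of them. In each of
  the first \<open>O(k)\<close> rounds a random distance-free claim reduces the number of such sets that are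
  still untouched by a factor \<open>exp (\<Omega>(2 ^ k))\<close>, until none is left. In the next \<open>k\<close> rounds Claimer
  plays greedily on each path of the distance graph. Every component of the graph of all \<open>k\<close>
  distances named in these rounds is then halved in each round, but has fewer than \<open>2 ^ k\<close> points
  at the outset, so nothing survives.
\<close>

section \<open>How the unclaimed set evolves along a play\<close>

lemma unclaimed_play_Suc:
  "unclaimed n (play \<sigma> \<tau> (Suc i)) =
     unclaimed n (play \<sigma> \<tau> i) - \<sigma> (play \<sigma> \<tau> i) (\<tau> (play \<sigma> \<tau> i))"
  by (auto simp: unclaimed_def Let_def)

lemma length_play [simp]: "length (play \<sigma> \<tau> i) = i"
  by (induction i) (simp_all add: Let_def)

lemma unclaimed_subset: "unclaimed n h \<subseteq> {1..n}"
  by (auto simp: unclaimed_def)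

section \<open>Lower bound\<close>

text \<open>Averaging: the ordered pairs of distinct points of \<open>A\<close> are shared among
  fewer than \<open>n\<close> distances, and \<open>P d\<close> has at most two of them for each
  \<open>x\<close> with \<open>x\<close> and \<open>x + d\<close> in \<open>A\<close>.\<close>

lemma popular_distance:
  assumes A: "A \<subseteq> {1..n}" and two: "2 \<le> card A"
  shows "\<exists>d\<in>{1..n - 1}. card A * (card A - 1) \<le> 2 * n * card {x \<in> A. x + d \<in> A}"
proof -
  define e where "e d = card {x \<in> A. x + d \<in> A}" for d
  define P where "P d = (\<lambda>x. (x, x + d)) ` {x \<in> A. x + d \<in> A} \<union>
    (\<lambda>x. (x + d, x)) ` {x \<in> A. x + d \<in> A}" for d
  have fin: "finite A"
    using A finite_subset by blast
  have "card A \<le> n"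
    using card_mono[OF _ A] by simp
  then have ne: "{1..n - 1} \<noteq> {}"
    using two by auto
  have P: "card (P d) \<le> 2 * e d" for d
  proof -
    have "card (P d) \<le> card ((\<lambda>x. (x, x + d)) ` {x \<in> A. x + d \<in> A}) +
        card ((\<lambda>x. (x + d, x)) ` {x \<in> A. x + d \<in> A})"
      unfolding P_def by (rule card_Un_le)
    also have "\<dots> \<le> e d + e d"
      unfolding e_def using fin by (intro add_mono card_image_le) auto
    finally show ?thesis by simp
  qed
  have "A \<times> A - (\<lambda>x. (x, x)) ` A \<subseteq> (\<Union>d\<in>{1..n - 1}. P d)"
  proof
    fix p assume "p \<in> A \<times> A - (\<lambda>x. (x, x)) ` A"
    then obtain x y where p: "p = (x, y)" "x \<in> A" "y \<in> A" "x \<noteq> y" by auto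
    then have b: "1 \<le> x" "x \<le> n" "1 \<le> y" "y \<le> n" using A by auto
    show "p \<in> (\<Union>d\<in>{1..n - 1}. P d)"
    proof (cases "x < y")
      case True
      then have "y - x \<in> {1..n - 1}" "p \<in> P (y - x)"
        using p b by (auto simp: P_def image_iff)
      then show ?thesis by blast
    next
      case False
      then have "x - y \<in> {1..n - 1}" "p \<in> P (x - y)"
        using p b by (auto simp: P_def image_iff)
      then show ?thesis by blast
    qed
  qed
  then have "card (A \<times> A - (\<lambda>x. (x, x)) ` A) \<le> card (\<Union>d\<in>{1..n - 1}. P d)"
    using fin by (intro card_mono) (auto simp: P_def)
  also have "\<dots> \<le> (\<Sum>d\<in>{1..n - 1}. card (P d))"
    by (rule card_UN_le) simp
  also have "\<dots> \<le> (\<Sum>d\<in>{1..n - 1}. 2 * e d)"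
    by (intro sum_mono P)
  finally have le: "card (A \<times> A - (\<lambda>x. (x, x)) ` A) \<le> (\<Sum>d\<in>{1..n - 1}. 2 * e d)" .
  have "card (A \<times> A - (\<lambda>x. (x, x)) ` A) = card A * card A - card ((\<lambda>x. (x, x)) ` A)"
    using fin by (subst card_Diff_subset) (auto simp: card_cartesian_product)
  also have "card ((\<lambda>x. (x, x)) ` A) = card A"
    by (intro card_image) (auto simp: inj_on_def)
  finally have eq: "card (A \<times> A - (\<lambda>x. (x, x)) ` A) = card A * (card A - 1)"
    by (simp add: algebra_simps)
  have "Max (e ` {1..n - 1}) \<in> e ` {1..n - 1}"
    using ne by (intro Max_in) auto
  then obtain d where d: "d \<in> {1..n - 1}" "Max (e ` {1..n - 1}) = e d" by auto
  have "(\<Sum>d\<in>{1..n - 1}. 2 * e d) \<le> of_nat (card {1..n - 1}) * (2 * e d)"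
  proof (rule sum_bounded_above)
    fix i assume "i \<in> {1..n - 1}"
    then have "e i \<le> Max (e ` {1..n - 1})" by (intro Max_ge) auto
    then show "2 * e i \<le> 2 * e d" using d by simp
  qed
  also have "\<dots> \<le> n * (2 * e d)" by simp
  finally show ?thesis
    using le eq d(1) by (intro bexI[of _ d]) (auto simp: e_def)
qed

text \<open>A \<open>d\<close>-free claim misses an end of each pair \<open>x\<close>,
  \<open>x + d\<close>, and a surviving point is an end of at most two such pairs. The 8 combines
  this 2, the 2 of \<open>popular_distance\<close>, and
  \<open>card A \<le> 2 * (card A - 1)\<close>.\<close>

lemma card_unclaimed_ge:
  assumes A: "A \<subseteq> {1..n}" and two: "2 \<le> card A"
  shows "\<exists>d\<in>{1..n - 1}. \<forall>C. dist_free d C \<longrightarrow> (card A)\<^sup>2 \<le> 8 * n * card (A - C)"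
proof -
  have fin: "finite A"
    using A finite_subset by blast
  obtain d where d: "d \<in> {1..n - 1}"
    and e: "card A * (card A - 1) \<le> 2 * n * card {x \<in> A. x + d \<in> A}"
    using popular_distance[OF assms] by auto
  have "(card A)\<^sup>2 \<le> 8 * n * card (A - C)" if C: "dist_free d C" for C
  proof -
    have "\<not> (x \<in> C \<and> x + d \<in> C)" for x
      using C unfolding dist_free_def by force
    then have "{x \<in> A. x + d \<in> A} \<subseteq> (A - C) \<union> (\<lambda>y. y - d) ` (A - C)"
      by (force simp: image_iff)
    then have "card {x \<in> A. x + d \<in> A} \<le> card ((A - C) \<union> (\<lambda>y. y - d) ` (A - C))"
      using fin by (intro card_mono) auto
    also have "\<dots> \<le> card (A - C) + card ((\<lambda>y. y - d) ` (A - C))"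
      by (rule card_Un_le)
    also have "\<dots> \<le> 2 * card (A - C)"
      using card_image_le[of "A - C" "\<lambda>y. y - d"] fin by simp
    finally have "2 * n * card {x \<in> A. x + d \<in> A} \<le> 2 * n * (2 * card (A - C))"
      by (rule mult_le_mono2)
    with e have *: "card A * (card A - 1) \<le> 2 * n * (2 * card (A - C))"
      by (rule order_trans)
    have "card A * card A \<le> card A * (2 * (card A - 1))"
      using two by (intro mult_left_mono) auto
    also have "\<dots> \<le> 2 * (2 * n * (2 * card (A - C)))"
      using mult_le_mono2[OF *, of 2] by (simp only: mult.left_commute)
    finally show ?thesis
      by (simp add: power2_eq_square)
  qed
  then show ?thesis using d by blast
qed

text \<open>The ratio of the unclaimed points to \<open>8 * n\<close> starts at 1/8 and is at worst
  squared in each round. The bound on \<open>k\<close> keeps at least two points unclaimed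
  throughout, so a popular distance always exists.\<close>

lemma not_claimer_can_win_within:
  assumes n: "2 \<le> n" and k: "8 ^ 2 ^ k \<le> 4 * n"
  shows "\<not> claimer_can_win_within n k"
proof
  assume "claimer_can_win_within n k"
  then obtain \<sigma> where \<sigma>: "claimer_strategy n \<sigma>"
    and win: "\<And>\<tau>. namer_strategy n \<tau> \<Longrightarrow> \<exists>i\<le>k. unclaimed n (play \<sigma> \<tau> i) = {}"
    unfolding claimer_can_win_within_def by blast
  \<comment> \<open>Below two points any legal distance is accepted, so that Namer's choice is legal
    at every history, reachable or not.\<close>
  define good where "good A d \<longleftrightarrow> d \<in> {1..n - 1} \<and>
    (2 \<le> card A \<longrightarrow> (\<forall>C. dist_free d C \<longrightarrow> (card A)\<^sup>2 \<le> 8 * n * card (A - C)))" for A d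
  have ex: "\<exists>d. good (unclaimed n h) d" for h
  proof (cases "2 \<le> card (unclaimed n h)")
    case True
    then show ?thesis
      using card_unclaimed_ge[OF unclaimed_subset, of n h] by (auto simp: good_def)
  next
    case False
    then have "good (unclaimed n h) 1" using n by (auto simp: good_def)
    then show ?thesis ..
  qed
  define \<tau> where "\<tau> h = (SOME d. good (unclaimed n h) d)" for h
  have \<tau>: "good (unclaimed n h) (\<tau> h)" for h
    unfolding \<tau>_def using ex by (rule someI_ex)
  have ns: "namer_strategy n \<tau>"
    unfolding namer_strategy_def using \<tau> by (simp add: good_def)
  define a where "a i = card (unclaimed n (play \<sigma> \<tau> i))" for i
  \<comment> \<open>With at most one point left, the invariant would give
    \<open>8 * n \<le> 8 ^ 2 ^ k \<le> 4 * n\<close>.\<close>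
  have a_ge: "2 \<le> a i" if "8 * n \<le> a i * 8 ^ 2 ^ i" "i \<le> k" for i
  proof (rule ccontr)
    assume "\<not> 2 \<le> a i"
    then have "a i * 8 ^ 2 ^ i \<le> 1 * 8 ^ 2 ^ i"
      by (intro mult_right_mono) auto
    also have "(8::nat) ^ 2 ^ i \<le> 8 ^ 2 ^ k"
      using that(2) by (intro power_increasing) auto
    finally show False
      using that(1) k n by simp
  qed
  have inv: "8 * n \<le> a i * 8 ^ 2 ^ i" if "i \<le> k" for i
    using that
  proof (induction i)
    case 0
    show ?case by (simp add: a_def unclaimed_def)
  next
    case (Suc i)
    let ?h = "play \<sigma> \<tau> i"
    have IH: "8 * n \<le> a i * 8 ^ 2 ^ i" using Suc by simp
    have "dist_free (\<tau> ?h) (\<sigma> ?h (\<tau> ?h))"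
      using \<sigma> \<tau>[of ?h] by (auto simp: claimer_strategy_def good_def)
    then have sq: "(a i)\<^sup>2 \<le> 8 * n * a (Suc i)"
      using \<tau>[of ?h] a_ge[OF IH] Suc.prems
      unfolding a_def unclaimed_play_Suc good_def by auto
    have "(8 * n) * (8 * n) \<le> (a i * 8 ^ 2 ^ i) * (a i * 8 ^ 2 ^ i)"
      by (rule mult_le_mono[OF IH IH])
    also have "\<dots> = (a i)\<^sup>2 * 8 ^ 2 ^ Suc i"
      by (simp add: power2_eq_square mult_2 power_add)
    also have "\<dots> \<le> (8 * n * a (Suc i)) * 8 ^ 2 ^ Suc i"
      using sq by (intro mult_right_mono) auto
    finally have "(8 * n) * (8 * n) \<le> (8 * n) * (a (Suc i) * 8 ^ 2 ^ Suc i)"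
      by (simp add: mult.assoc)
    then show ?case using n by (simp only: mult_le_cancel1)
  qed
  obtain i where "i \<le> k" "unclaimed n (play \<sigma> \<tau> i) = {}"
    using win[OF ns] by blast
  then show False
    using a_ge[OF inv, of i] by (simp add: a_def)
qed

lemma claimer_can_win_within_game_length: "claimer_can_win_within n (game_length n)"
  unfolding game_length_def by (rule LeastI[OF claimer_can_win_within_n])

lemma claimer_can_win_within_mono:
  "claimer_can_win_within n k \<Longrightarrow> k \<le> l \<Longrightarrow> claimer_can_win_within n l"
  unfolding claimer_can_win_within_def by (meson le_trans)

lemma less_game_length:
  "2 \<le> n \<Longrightarrow> 8 ^ 2 ^ k \<le> 4 * n \<Longrightarrow> k < game_length n"
  using not_claimer_can_win_within claimer_can_win_within_game_length
    claimer_can_win_within_mono not_le by metis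

section \<open>Greedy claims\<close>

text \<open>The guard \<open>0 < d\<close> secures termination, and \<open>d \<le> x\<close> keeps
  truncated subtraction from producing a false predecessor.\<close>

fun greedy :: "nat set \<Rightarrow> nat \<Rightarrow> nat \<Rightarrow> bool" where
  "greedy A d x \<longleftrightarrow> x \<in> A \<and> (if 0 < d \<and> d \<le> x then \<not> greedy A d (x - d) else True)"

declare greedy.simps [simp del]

lemma greedy_subset: "Collect (greedy A d) \<subseteq> A"
  using greedy.simps by blast

lemma dist_free_greedy:
  assumes "0 < d"
  shows "dist_free d (Collect (greedy A d))"
proof -
  have "\<not> (greedy A d x \<and> greedy A d (x + d))" for x
    using assms greedy.simps[of A d "x + d"] by simp
  moreover have "\<exists>z. x = z + d \<and> y = z \<or> y = z + d \<and> x = z" if "\<bar>int x - int y\<bar> = int d" for x y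
  proof (cases "x < y")
    case True
    then show ?thesis using that by (intro exI[of _ x]) auto
  next
    case False
    then show ?thesis using that by (intro exI[of _ y]) auto
  qed
  ultimately show ?thesis
    unfolding dist_free_def by blast
qed

text \<open>Charges only go down by \<open>d\<close>, so closure of \<open>K\<close> under such
  downward steps within \<open>A\<close> suffices.\<close>

lemma card_greedy:
  assumes fin: "finite K" and KA: "K \<subseteq> A" and cl: "\<And>y. y \<in> A \<Longrightarrow> y + d \<in> K \<Longrightarrow> y \<in> K"
  shows "2 * card (K - Collect (greedy A d)) \<le> card K"
proof -
  let ?C = "Collect (greedy A d)"
  \<comment> \<open>An unclaimed point is charged to its predecessor, which is claimed.\<close>
  have step: "0 < d \<and> d \<le> x \<and> greedy A d (x - d)" if "x \<in> A - ?C" for x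
    using that greedy.simps[of A d x] by (auto split: if_splits)
  have "inj_on (\<lambda>x. x - d) (K - ?C)"
    using step KA by (intro inj_onI) (metis DiffD1 DiffD2 DiffI eq_diff_iff subsetD)
  moreover have "(\<lambda>x. x - d) ` (K - ?C) \<subseteq> K \<inter> ?C"
  proof (rule image_subsetI)
    fix x assume x: "x \<in> K - ?C"
    then have s: "d \<le> x" "greedy A d (x - d)" using step KA by auto
    then have "x - d \<in> A" using greedy_subset by auto
    then show "x - d \<in> K \<inter> ?C" using s x cl by auto
  qed
  ultimately have "card (K - ?C) \<le> card (K \<inter> ?C)"
    using fin by (intro card_inj_on_le) auto
  moreover have "card K = card (K \<inter> ?C) + card (K - ?C)"
    using fin by (rule card_Int_Diff)
  ultimately show ?thesis by simp
qed

text \<open>Closure is asked in the initial set for all \<open>k\<close> distances at once. Each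
  \<open>K \<inter> A i\<close> inherits it, so one fixed \<open>K\<close> is halved in every
  round.\<close>

lemma card_greedy_iterate:
  assumes fin: "finite (A 0)"
    and step: "\<And>i. i < k \<Longrightarrow> A (Suc i) = A i - Collect (greedy (A i) (d i))"
    and K: "K \<subseteq> A 0"
    and cl: "\<And>i y. i < k \<Longrightarrow> y \<in> A 0 \<Longrightarrow> y + d i \<in> K \<Longrightarrow> y \<in> K"
    and i: "i \<le> k"
  shows "A i \<subseteq> A 0 \<and> 2 ^ i * card (K \<inter> A i) \<le> card K"
  using i
proof (induction i)
  case 0
  show ?case using fin K by (simp add: card_mono finite_subset)
next
  case (Suc i)
  let ?C = "Collect (greedy (A i) (d i))"
  have A: "A i \<subseteq> A 0" and IH: "2 ^ i * card (K \<inter> A i) \<le> card K"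
    using Suc by auto
  have "finite (K \<inter> A i)"
    using fin K by (meson finite_Int finite_subset)
  then have "2 * card (K \<inter> A i - ?C) \<le> card (K \<inter> A i)"
    using Suc.prems A cl[of i] by (intro card_greedy) auto
  moreover have "K \<inter> A (Suc i) = K \<inter> A i - ?C"
    using step[of i] Suc.prems by auto
  ultimately have "2 ^ i * (2 * card (K \<inter> A (Suc i))) \<le> 2 ^ i * card (K \<inter> A i)"
    by simp
  then have "2 ^ Suc i * card (K \<inter> A (Suc i)) \<le> card K"
    using order_trans[OF _ IH] by (simp add: mult.assoc mult.left_commute)
  then show ?case using A step[of i] Suc.prems by auto
qed

section \<open>Clusters\<close>

text \<open>\<open>clusters n D j\<close> contains the connected sets with \<open>j + 1\<close> (not \<open>j\<close>) points.\<close>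

primrec clusters :: "nat \<Rightarrow> nat set \<Rightarrow> nat \<Rightarrow> nat set set" where
  "clusters n D 0 = (\<lambda>x. {x}) ` {1..n}"
| "clusters n D (Suc j) = (\<Union>S\<in>clusters n D j. (\<lambda>y. insert y S) `
     {y \<in> {1..n} - S. \<exists>x\<in>S. \<exists>d\<in>D. y = x + d \<or> x = y + d})"

lemma clusters_card:
  "S \<in> clusters n D j \<Longrightarrow> S \<subseteq> {1..n} \<and> finite S \<and> card S = Suc j"
  by (induction j arbitrary: S) auto

lemma finite_clusters [simp]: "finite (clusters n D j)"
  by (induction j) auto

text \<open>A new point is \<open>x + d\<close> or \<open>x - d\<close> with \<open>x\<close> among
  at most \<open>m\<close> points and \<open>d\<close> in \<open>D\<close>, which leaves at most
  \<open>2 * card D * m\<close> choices per step.\<close>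

lemma card_clusters:
  assumes D: "finite D" and j: "j \<le> m"
  shows "card (clusters n D j) \<le> n * (2 * card D * m) ^ j"
  using j
proof (induction j)
  case 0
  show ?case using card_image_le[of "{1..n}" "\<lambda>x. {x}"] by simp
next
  case (Suc j)
  define N where "N S = {y \<in> {1..n} - S. \<exists>x\<in>S. \<exists>d\<in>D. y = x + d \<or> x = y + d}" for S
  have N: "card (N S) \<le> 2 * card D * m" if S: "S \<in> clusters n D j" for S
  proof -
    have fS: "finite S" and cS: "card S = Suc j"
      using clusters_card[OF S] by auto
    have "N S \<subseteq> (\<lambda>(x, d). x + d) ` (S \<times> D) \<union> (\<lambda>(x, d). x - d) ` (S \<times> D)"
      by (force simp: N_def image_iff)
    then have "card (N S) \<le> card ((\<lambda>(x, d). x + d) ` (S \<times> D) \<union> (\<lambda>(x, d). x - d) ` (S \<times> D))"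
      using fS D by (intro card_mono) auto
    also have "\<dots> \<le> card ((\<lambda>(x, d). x + d) ` (S \<times> D)) + card ((\<lambda>(x, d). x - d) ` (S \<times> D))"
      by (rule card_Un_le)
    also have "\<dots> \<le> card (S \<times> D) + card (S \<times> D)"
      using fS D by (intro add_mono card_image_le) auto
    also have "\<dots> = 2 * card D * Suc j"
      using cS by (simp add: card_cartesian_product)
    also have "\<dots> \<le> 2 * card D * m"
      using Suc.prems by (intro mult_left_mono) auto
    finally show ?thesis .
  qed
  have "card (clusters n D (Suc j)) \<le> (\<Sum>S\<in>clusters n D j. card ((\<lambda>y. insert y S) ` N S))"
    unfolding clusters.simps N_def[symmetric] by (rule card_UN_le) simp
  also have "\<dots> \<le> (\<Sum>S\<in>clusters n D j. 2 * card D * m)"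
    by (intro sum_mono order_trans[OF card_image_le N]) (auto simp: N_def)
  also have "\<dots> = card (clusters n D j) * (2 * card D * m)" by simp
  also have "\<dots> \<le> (n * (2 * card D * m) ^ j) * (2 * card D * m)"
    using Suc by (intro mult_right_mono) auto
  finally show ?case by (simp add: algebra_simps)
qed

text \<open>Edges stay inside \<open>A\<close>, unlike in \<open>clusters\<close>: components are
  taken in the set actually unclaimed, whereas the family of clusters must be fixed before the
  play.\<close>

definition adjacent :: "nat set \<Rightarrow> nat set \<Rightarrow> nat rel" where
  "adjacent A D = {(u, v). u \<in> A \<and> v \<in> A \<and> (\<exists>d\<in>D. v = u + d \<or> u = v + d)}"

lemma cluster_in_component:
  assumes A: "A \<subseteq> {1..n}" and x: "x \<in> A" and j: "j < card ((adjacent A D)\<^sup>* `` {x})"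
  shows "\<exists>S\<in>clusters n D j. x \<in> S \<and> S \<subseteq> (adjacent A D)\<^sup>* `` {x}"
  using j
proof (induction j)
  case 0
  show ?case using A x by (intro bexI[of _ "{x}"]) auto
next
  case (Suc j)
  let ?K = "(adjacent A D)\<^sup>* `` {x}"
  obtain S where S: "S \<in> clusters n D j" "x \<in> S" "S \<subseteq> ?K"
    using Suc by auto
  \<comment> \<open>Otherwise \<open>S\<close> would be closed under adjacency and contain the whole
    component, which has more than \<open>Suc j\<close> points.\<close>
  have "\<exists>u v. u \<in> S \<and> v \<notin> S \<and> (u, v) \<in> adjacent A D"
  proof (rule ccontr)
    assume no: "\<not> ?thesis"
    have "y \<in> S" if "(x, y) \<in> (adjacent A D)\<^sup>*" for y
      using that by induction (use S no in auto)
    then have "?K \<subseteq> S" by auto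
    then have "card ?K \<le> Suc j"
      using clusters_card[OF S(1)] card_mono by metis
    then show False using Suc.prems by simp
  qed
  then obtain u v where uv: "u \<in> S" "v \<notin> S" "(u, v) \<in> adjacent A D" by blast
  then have "insert v S \<in> clusters n D (Suc j)"
    using S A by (auto simp: adjacent_def intro!: bexI[of _ S] imageI)
  moreover have "v \<in> ?K"
    using uv S by (meson Image_singleton_iff rtrancl.rtrancl_into_rtrancl subsetD)
  ultimately show ?case using S by blast
qed

section \<open>Thinning claims\<close>

text \<open>
  For a random \<open>X\<close>, each \<open>x\<close> lies in the distance-free set \<open>{x \<in> X. x + d \<notin> X}\<close> with probability
  \<open>1 / 4\<close>, independently over any \<open>T\<close> as below.
\<close>

lemma card_upward_pairs:
  fixes d :: nat
  assumes "finite T" "finite U" "T \<union> (\<lambda>x. x + d) ` T \<subseteq> U" "T \<inter> (\<lambda>x. x + d) ` T = {}"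
  shows "4 ^ card T * card {X \<in> Pow U. \<forall>x\<in>T. x \<in> X \<longrightarrow> x + d \<in> X} \<le> 3 ^ card T * 2 ^ card U"
  using assms
proof (induction T arbitrary: U rule: finite_induct)
  case empty
  then show ?case by (simp flip: Pow_def add: card_Pow)
next
  case (insert x T)
  define U' where "U' = U - {x, x + d}"
  let ?N = "{X \<in> Pow U. \<forall>y\<in>insert x T. y \<in> X \<longrightarrow> y + d \<in> X}"
  let ?N' = "{X \<in> Pow U'. \<forall>y\<in>T. y \<in> X \<longrightarrow> y + d \<in> X}"
  \<comment> \<open>Only three of the four traces on \<open>{x, x + d}\<close> are allowed. The cost
    \<open>4 * 3\<close> balances the gain \<open>3 * 2 ^ 2\<close> from the two points removed from
    \<open>U\<close>.\<close>
  let ?Y = "{{}, {x + d}, {x, x + d}}"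
  have ne: "x \<noteq> x + d" "x \<in> U" "x + d \<in> U" and fU: "finite U"
    using insert.prems by auto
  have cU: "card U = card U' + 2"
    unfolding U'_def using ne fU card_mono[OF fU, of "{x, x + d}"]
    by (subst card_Diff_subset) auto
  have sub: "T \<union> (\<lambda>x. x + d) ` T \<subseteq> U'" "T \<inter> (\<lambda>x. x + d) ` T = {}"
    using insert.prems insert.hyps unfolding U'_def by auto
  have IH: "4 ^ card T * card ?N' \<le> 3 ^ card T * 2 ^ card U'"
    using insert.IH[OF _ sub] fU by (simp add: U'_def)
  have "inj_on (\<lambda>X. (X \<inter> U', X \<inter> {x, x + d})) ?N"
    by (rule inj_onI) (auto simp: U'_def)
  moreover have "(\<lambda>X. (X \<inter> U', X \<inter> {x, x + d})) ` ?N \<subseteq> ?N' \<times> ?Y"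
  proof (rule image_subsetI)
    fix X assume X: "X \<in> ?N"
    have "X \<inter> U' \<in> ?N'" using X sub by auto
    moreover have "X \<inter> {x, x + d} \<in> ?Y" using X by auto
    ultimately show "(X \<inter> U', X \<inter> {x, x + d}) \<in> ?N' \<times> ?Y" by (rule SigmaI)
  qed
  ultimately have "card ?N \<le> card (?N' \<times> ?Y)"
    using fU by (intro card_inj_on_le) (auto simp: U'_def)
  also have "\<dots> \<le> card ?N' * 3"
    unfolding card_cartesian_product
    by (intro mult_left_mono) (auto simp: card_insert_if)
  finally have "4 ^ card (insert x T) * card ?N \<le> 4 ^ card (insert x T) * (card ?N' * 3)"
    by (intro mult_left_mono) auto
  also have "\<dots> = 12 * (4 ^ card T * card ?N')"
    using insert.hyps by simp
  also have "\<dots> \<le> 12 * (3 ^ card T * 2 ^ card U')"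
    using IH by (intro mult_left_mono) auto
  also have "\<dots> = 3 ^ card (insert x T) * 2 ^ card U"
    using insert.hyps cU by simp
  finally show ?case .
qed

text \<open>First moment method: for uniform random \<open>X\<close>, each \<open>S\<close> is
  missed by \<open>C X\<close> with probability at most \<open>(3 / 4) ^ h\<close>, so some
  \<open>X\<close> does at least as well as this average.\<close>

lemma thinning_claim:
  assumes F: "finite F" and FA: "\<And>S. S \<in> F \<Longrightarrow> S \<subseteq> A \<and> 2 * h \<le> card S"
    and A: "A \<subseteq> {1..n}" and d: "d \<in> {1..n - 1}"
  shows "\<exists>C\<subseteq>A. dist_free d C \<and>
    real (card {S \<in> F. S \<inter> C = {}}) \<le> (3 / 4) ^ h * real (card F)"
proof -
  \<comment> \<open>Large enough to contain \<open>x + d\<close> for every \<open>x\<close> in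
    \<open>A\<close>, as \<open>d < n\<close>.\<close>
  define U where "U = {..2 * n}"
  define C where "C X = {x \<in> A. x \<in> X \<and> x + d \<notin> X}" for X
  have free: "dist_free d (C X)" for X
    unfolding dist_free_def
  proof (intro ballI notI)
    fix x y assume "x \<in> C X" "y \<in> C X" "\<bar>int x - int y\<bar> = int d"
    moreover from this(3) have "x = y + d \<or> y = x + d" by linarith
    ultimately show False by (auto simp: C_def)
  qed
  have each: "real (card {X \<in> Pow U. S \<inter> C X = {}}) \<le> (3 / 4) ^ h * 2 ^ card U"
    if S: "S \<in> F" for S
  proof -
    \<comment> \<open>One of the two parity classes contains half of \<open>S\<close>, and shifting by \<open>d\<close> leaves the class.\<close>
    define P where "P b = {x \<in> S. even (x div d) = b}" for b
    have SA: "S \<subseteq> A" and Sh: "2 * h \<le> card S" using FA S by auto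
    have fS: "finite S" using SA A by (meson finite_atLeastAtMost finite_subset)
    have "card S = card (P True) + card (P False)"
      unfolding P_def using fS by (subst card_Un_disjoint[symmetric]) (auto intro: arg_cong[where f = card])
    then obtain b where b: "h \<le> card (P b)"
      using Sh by (metis add_less_mono mult_2 not_le)
    have fT: "finite (P b)" using fS by (simp add: P_def)
    have sub: "P b \<union> (\<lambda>x. x + d) ` P b \<subseteq> U"
      using SA A d by (force simp: P_def U_def)
    have disj: "P b \<inter> (\<lambda>x. x + d) ` P b = {}"
      using d by (auto simp: P_def)
    let ?N = "{X \<in> Pow U. \<forall>x\<in>P b. x \<in> X \<longrightarrow> x + d \<in> X}"
    have "real (4 ^ card (P b) * card ?N) \<le> real (3 ^ card (P b) * 2 ^ card U)"
      by (intro of_nat_mono card_upward_pairs fT sub disj) (simp add: U_def)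
    then have "real (card ?N) \<le> (3 / 4) ^ card (P b) * 2 ^ card U"
      by (simp add: field_simps)
    also have "\<dots> \<le> (3 / 4) ^ h * 2 ^ card U"
      using b by (intro mult_right_mono power_decreasing) auto
    finally have N: "real (card ?N) \<le> (3 / 4) ^ h * 2 ^ card U" .
    have "{X \<in> Pow U. S \<inter> C X = {}} \<subseteq> ?N"
      using SA by (auto simp: C_def P_def)
    then have "card {X \<in> Pow U. S \<inter> C X = {}} \<le> card ?N"
      by (intro card_mono) (auto simp: U_def)
    then show ?thesis using N by linarith
  qed
  \<comment> \<open>If every \<open>X\<close> were too bad, counting the pairs \<open>(X, S)\<close>
    with \<open>S\<close> missed by \<open>C X\<close> in both orders would contradict
    \<open>each\<close>.\<close>
  have "\<exists>X\<in>Pow U. real (card {S \<in> F. S \<inter> C X = {}}) \<le> (3 / 4) ^ h * real (card F)"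
  proof (rule ccontr)
    assume "\<not> ?thesis"
    then have "(\<Sum>X\<in>Pow U. (3 / 4) ^ h * real (card F)) <
        (\<Sum>X\<in>Pow U. real (card {S \<in> F. S \<inter> C X = {}}))"
      by (intro sum_strict_mono) (auto simp: U_def not_le)
    also have "\<dots> = real (\<Sum>X\<in>Pow U. card {S \<in> F. S \<inter> C X = {}})"
      by simp
    also have "(\<Sum>X\<in>Pow U. card {S \<in> F. S \<inter> C X = {}}) =
        (\<Sum>S\<in>F. card {X \<in> Pow U. S \<inter> C X = {}})"
      using F by (intro sum_multicount_gen) (auto simp: U_def)
    also have "real \<dots> \<le> (\<Sum>S\<in>F. (3 / 4) ^ h * 2 ^ card U)"
      unfolding of_nat_sum by (intro sum_mono each)
    finally show False
      by (simp add: card_Pow U_def)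
  qed
  then obtain X where "real (card {S \<in> F. S \<inter> C X = {}}) \<le> (3 / 4) ^ h * real (card F)"
    by blast
  then show ?thesis
    using free by (intro exI[of _ "C X"]) (auto simp: C_def)
qed

section \<open>Upper bound\<close>

text \<open>During thinning the distances of the later greedy rounds are unknown, so
  \<open>F\<close> has to contain the clusters for every possible set \<open>D\<close> of at most
  \<open>k\<close> distances.\<close>

lemma claimer_can_win_within_thinning_greedy:
  fixes F :: "nat set set"
  assumes F: "finite F" and card_F: "\<And>S. S \<in> F \<Longrightarrow> 2 * h \<le> card S"
    and clus: "\<And>D. D \<subseteq> {1..n - 1} \<Longrightarrow> finite D \<Longrightarrow> card D \<le> k \<Longrightarrow> clusters n D (2 ^ k - 1) \<subseteq> F"
    and r: "((3 / 4) ^ h) ^ r * real (card F) < 1"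
  shows "claimer_can_win_within n (r + k)"
proof -
  define left where "left A = {S \<in> F. S \<subseteq> A}" for A
  define thin where "thin A d C \<longleftrightarrow> C \<subseteq> A \<and> dist_free d C \<and>
    real (card (left (A - C))) \<le> (3 / 4) ^ h * real (card (left A))" for A d C
  \<comment> \<open>The length of the history tells which of the two phases is on.\<close>
  define \<sigma> :: "history \<Rightarrow> nat \<Rightarrow> nat set" where
    "\<sigma> hs d = (let A = unclaimed n hs in
       if length hs < r then SOME C. thin A d C else Collect (greedy A d))" for hs d
  have thin: "thin (unclaimed n hs) d (SOME C. thin (unclaimed n hs) d C)"
    if d: "d \<in> {1..n - 1}" for hs d
  proof -
    let ?A = "unclaimed n hs"
    have "\<exists>C\<subseteq>?A. dist_free d C \<and>
      real (card {S \<in> left ?A. S \<inter> C = {}}) \<le> (3 / 4) ^ h * real (card (left ?A))"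
      using F card_F by (intro thinning_claim[OF _ _ unclaimed_subset d]) (simp_all add: left_def)
    then obtain C where C: "C \<subseteq> ?A" "dist_free d C"
      "real (card {S \<in> left ?A. S \<inter> C = {}}) \<le> (3 / 4) ^ h * real (card (left ?A))"
      by blast
    moreover have "{S \<in> left ?A. S \<inter> C = {}} = left (?A - C)"
      by (auto simp: left_def)
    ultimately have "thin ?A d C" by (simp add: thin_def)
    then show ?thesis by (rule someI)
  qed
  have \<sigma>: "claimer_strategy n \<sigma>"
    unfolding claimer_strategy_def
  proof (intro allI ballI)
    fix hs d assume d: "d \<in> {1..n - 1}"
    show "\<sigma> hs d \<subseteq> unclaimed n hs \<and> dist_free d (\<sigma> hs d)"
    proof (cases "length hs < r")
      case True
      then show ?thesis
        using thin[OF d, of hs] unfolding \<sigma>_def Let_def thin_def by simp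
    next
      case False
      then show ?thesis
        using d dist_free_greedy[of d] greedy_subset by (simp add: \<sigma>_def Let_def)
    qed
  qed
  have "unclaimed n (play \<sigma> \<tau> (r + k)) = {}" if ns: "namer_strategy n \<tau>" for \<tau>
  proof (rule ccontr)
    assume "unclaimed n (play \<sigma> \<tau> (r + k)) \<noteq> {}"
    then obtain x where x: "x \<in> unclaimed n (play \<sigma> \<tau> (r + k))" by auto
    have \<tau>: "\<tau> hs \<in> {1..n - 1}" for hs
      using ns by (simp add: namer_strategy_def)
    define A where "A i = unclaimed n (play \<sigma> \<tau> (r + i))" for i
    define d where "d i = \<tau> (play \<sigma> \<tau> (r + i))" for i
    define D where "D = d ` {..<k}"
    \<comment> \<open>The component of a supposed survivor \<open>x\<close>, taken in the set left
      by thinning, for the distances named only afterwards.\<close>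
    define K where "K = (adjacent (A 0) D)\<^sup>* `` {x}"
    have phase1: "real (card (left (unclaimed n (play \<sigma> \<tau> i)))) \<le>
        ((3 / 4) ^ h) ^ i * real (card F)" if "i \<le> r" for i
      using that
    proof (induction i)
      case 0
      show ?case using F by (auto simp: left_def intro: card_mono)
    next
      case (Suc i)
      let ?hs = "play \<sigma> \<tau> i"
      have "thin (unclaimed n ?hs) (\<tau> ?hs) (\<sigma> ?hs (\<tau> ?hs))"
        using thin[OF \<tau>[of ?hs], of ?hs] Suc.prems unfolding \<sigma>_def Let_def by simp
      then have "real (card (left (unclaimed n (play \<sigma> \<tau> (Suc i))))) \<le>
          (3 / 4) ^ h * real (card (left (unclaimed n ?hs)))"
        unfolding unclaimed_play_Suc thin_def by blast
      also have "\<dots> \<le> (3 / 4) ^ h * (((3 / 4) ^ h) ^ i * real (card F))"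
        using Suc by (intro mult_left_mono) auto
      finally show ?case by (simp add: mult.assoc)
    qed
    have "real (card (left (A 0))) < 1"
      using phase1[of r] r by (simp add: A_def)
    then have no: "left (A 0) = {}"
      using F by (simp add: left_def)
    have A0: "A 0 \<subseteq> {1..n}" by (simp only: A_def unclaimed_subset)
    have step: "A (Suc i) = A i - Collect (greedy (A i) (d i))" for i
      using unclaimed_play_Suc[of n \<sigma> \<tau> "r + i"] by (simp add: A_def d_def \<sigma>_def Let_def)
    have sub: "A i \<subseteq> A 0" for i
      by (induction i) (use step in auto)
    have xA: "x \<in> A 0" "x \<in> A k" using x sub by (auto simp: A_def)
    have KA: "K \<subseteq> A 0"
    proof
      fix y assume "y \<in> K"
      then have "(x, y) \<in> (adjacent (A 0) D)\<^sup>*" by (simp add: K_def)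
      then show "y \<in> A 0" by cases (use xA in \<open>auto simp: adjacent_def\<close>)
    qed
    have cl: "y \<in> K" if "i < k" "y \<in> A 0" "y + d i \<in> K" for i y
    proof -
      have "(y + d i, y) \<in> adjacent (A 0) D"
        using that KA by (auto simp: adjacent_def D_def)
      then show ?thesis
        using that(3) unfolding K_def by (meson Image_singleton_iff rtrancl.rtrancl_into_rtrancl)
    qed
    have "2 ^ k * card (K \<inter> A k) \<le> card K"
      using card_greedy_iterate[OF finite_subset[OF A0] step KA cl, of k] by simp
    moreover have "card (K \<inter> A k) > 0"
      using xA KA A0 finite_subset by (subst card_gt_0_iff) (auto simp: K_def intro: finite_subset)
    \<comment> \<open>A survivor after \<open>k\<close> halvings forces \<open>K\<close> to have at
      least \<open>2 ^ k\<close> points, hence to contain a cluster that thinning never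
      touched.\<close>
    ultimately have "2 ^ k \<le> card K"
      by (metis One_nat_def Suc_leI dual_order.trans mult.right_neutral mult_le_mono2)
    then have "2 ^ k - 1 < card K"
      by (metis diff_less le_less_trans less_le_trans less_numeral_extra(1) pos2 zero_less_power)
    then obtain S where S: "S \<in> clusters n D (2 ^ k - 1)" "S \<subseteq> K"
      using cluster_in_component[OF A0 xA(1)] unfolding K_def by blast
    moreover have "D \<subseteq> {1..n - 1}" "finite D" "card D \<le> k"
      using \<tau> card_image_le[of "{..<k}" d] by (auto simp: D_def d_def)
    ultimately have "S \<in> left (A 0)"
      using clus KA by (auto simp: left_def)
    then show False using no by simp
  qed
  then show ?thesis
    unfolding claimer_can_win_within_def using \<sigma> by blast
qed

text \<open>Here \<open>h\<close> is \<open>2 ^ (k - 1)\<close>, half the size of a cluster.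
  Distance sets are represented by lists of length at most \<open>k\<close>; repeated
  representations only enlarge the upper bound.\<close>

lemma claimer_can_win_within_loglog:
  assumes k: "1 \<le> k" and n: "n \<le> 2 ^ 2 ^ k"
  shows "claimer_can_win_within n (18 * (k + 1) + k)"
proof (rule claimer_can_win_within_thinning_greedy)
  define L where "L = {ds. set ds \<subseteq> {1..n - 1} \<and> length ds \<le> k}"
  let ?m = "2 ^ k :: nat"
  let ?F = "\<Union>ds\<in>L. clusters n (set ds) (?m - 1)"
  have finL: "finite L"
    unfolding L_def by (rule finite_lists_length_le) simp
  show "finite ?F" using finL by simp
  show "2 * 2 ^ (k - 1) \<le> card S" if "S \<in> ?F" for S
    using that k clusters_card by (cases k) fastforce+
  show "clusters n D (?m - 1) \<subseteq> ?F" if D: "D \<subseteq> {1..n - 1}" "finite D" "card D \<le> k" for D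
  proof -
    obtain ds where "set ds = D" "length ds = card D"
      using D(2) by (metis distinct_card finite_distinct_list)
    then have "ds \<in> L" "D = set ds" using D by (auto simp: L_def)
    then show ?thesis by blast
  qed
  \<comment> \<open>The binary exponent bounding the size of the family: \<open>(k + 1) * ?m\<close>
    for the lists plus \<open>(2 * k + 2) * ?m\<close> for the clusters of each.\<close>
  let ?N = "3 * (k + 1) * ?m"
  have clus: "card (clusters n (set ds) (?m - 1)) \<le> 2 ^ (?m + (2 * k + 1) * ?m)" if "ds \<in> L" for ds
  proof -
    have ds: "card (set ds) \<le> k"
      using that card_length[of ds] by (simp add: L_def)
    have "2 * card (set ds) * ?m \<le> 2 * 2 ^ k * 2 ^ k"
      using order_trans[OF ds less_imp_le[OF less_exp]] by (intro mult_mono) auto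
    also have "\<dots> = 2 ^ (2 * k + 1)"
      by (simp add: power_mult power2_eq_square flip: power_mult_distrib)
    finally have base: "2 * card (set ds) * ?m \<le> 2 ^ (2 * k + 1)" .
    have "card (clusters n (set ds) (?m - 1)) \<le> n * (2 * card (set ds) * ?m) ^ (?m - 1)"
      by (rule card_clusters) auto
    also have "\<dots> \<le> 2 ^ ?m * (2 ^ (2 * k + 1)) ^ (?m - 1)"
      using n base by (intro mult_mono power_mono) auto
    also have "\<dots> \<le> 2 ^ ?m * (2 ^ (2 * k + 1)) ^ ?m"
      by (intro mult_left_mono power_increasing) auto
    finally show ?thesis by (simp only: power_add power_mult)
  qed
  have "card L = (\<Sum>i\<le>k. card {1..n - 1} ^ i)"
    unfolding L_def by (rule card_lists_length_le) simp
  also have "\<dots> \<le> (\<Sum>i\<le>k. 2 ^ (?m * k))"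
  proof (rule sum_mono)
    fix i assume i: "i \<in> {..k}"
    have "card {1..n - 1} ^ i \<le> (2 ^ ?m) ^ i"
      using n by (intro power_mono) auto
    also have "\<dots> \<le> (2 ^ ?m) ^ k"
      using i by (intro power_increasing) auto
    finally show "card {1..n - 1} ^ i \<le> 2 ^ (?m * k)" by (simp only: power_mult)
  qed
  also have "\<dots> = (k + 1) * 2 ^ (?m * k)" by simp
  also have "\<dots> \<le> 2 ^ ?m * 2 ^ (?m * k)"
  proof (rule mult_right_mono)
    have "k + 1 \<le> ?m" using less_exp[of k] by (simp add: Suc_le_eq)
    also have "\<dots> \<le> 2 ^ ?m" using less_exp[of ?m] by (rule less_imp_le)
    finally show "k + 1 \<le> 2 ^ ?m" .
  qed simp
  finally have cL: "card L \<le> 2 ^ (?m + ?m * k)" by (simp only: power_add)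
  have "card ?F \<le> (\<Sum>ds\<in>L. card (clusters n (set ds) (?m - 1)))"
    using finL by (rule card_UN_le)
  also have "\<dots> \<le> (\<Sum>ds\<in>L. 2 ^ (?m + (2 * k + 1) * ?m))"
    by (intro sum_mono clus)
  also have "\<dots> \<le> 2 ^ (?m + ?m * k) * 2 ^ (?m + (2 * k + 1) * ?m)"
    using cL by simp
  also have "\<dots> = 2 ^ ?N"
    by (simp only: power_add[symmetric]) (simp add: algebra_simps)
  finally have "real (card ?F) \<le> real (2 ^ ?N)"
    by (rule of_nat_mono)
  then have F: "real (card ?F) \<le> 2 ^ ?N" by simp
  \<comment> \<open>The 18 makes the total thinning exponent \<open>3 * ?N\<close>; the cube is used
    because \<open>(3 / 4) ^ 3 * 2 = 27 / 32\<close> is below 1.\<close>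
  have "2 ^ (k - 1) * (18 * (k + 1)) = 3 * ?N"
    using k by (cases k) auto
  then have eq: "((3 / 4 :: real) ^ (2 ^ (k - 1))) ^ (18 * (k + 1)) = ((3 / 4) ^ 3) ^ ?N"
    by (simp only: power_mult[symmetric])
  have "((3 / 4 :: real) ^ (2 ^ (k - 1))) ^ (18 * (k + 1)) * real (card ?F) \<le>
      ((3 / 4) ^ 3) ^ ?N * 2 ^ ?N"
    unfolding eq using F by (intro mult_left_mono) auto
  also have "\<dots> = (27 / 32) ^ ?N"
    by (simp only: power_mult_distrib[symmetric]) (simp add: power3_eq_cube)
  also have "\<dots> < 1"
    by (subst power_less_one_iff) auto
  finally show "((3 / 4) ^ (2 ^ (k - 1))) ^ (18 * (k + 1)) * real (card ?F) < 1" .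
qed

lemma game_length_le:
  "1 \<le> k \<Longrightarrow> n \<le> 2 ^ 2 ^ k \<Longrightarrow> game_length n \<le> 18 * (k + 1) + k"
  unfolding game_length_def by (rule Least_le) (rule claimer_can_win_within_loglog)

section \<open>From doubly exponential thresholds to iterated logarithms\<close>

lemma loglog_bounds:
  assumes n: "3 \<le> n"
  shows "(ln (ln (real n)) - ln (ln 8)) / ln 2 \<le> real (game_length n)"
    and "real (game_length n) \<le> 19 * ((ln (ln (real n)) - ln (ln 2)) / ln 2) + 56"
proof -
  have ln2: "0 < ln (2 :: real)" by simp
  have ln3: "1 \<le> ln (3 :: real)"
    using exp_le by (subst ln_ge_iff) auto
  have lnn: "1 \<le> ln (real n)"
    using n by (intro order_trans[OF ln3]) simp
  let ?g = "game_length n"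
  show "(ln (ln (real n)) - ln (ln 8)) / ln 2 \<le> real ?g"
  proof -
    \<comment> \<open>Contrapositive of \<open>less_game_length\<close> at \<open>k = ?g\<close>,
      which cannot be less than itself.\<close>
    have "n \<le> 8 ^ 2 ^ ?g"
      using less_game_length[of n ?g] n by linarith
    then have "real n \<le> real (8 ^ 2 ^ ?g)" by (rule of_nat_mono)
    then have "ln (real n) \<le> ln (8 ^ 2 ^ ?g)"
      using n by (subst ln_le_cancel_iff) auto
    also have "\<dots> = 2 ^ ?g * ln 8"
      by (subst ln_realpow) auto
    finally have "ln (ln (real n)) \<le> ln (2 ^ ?g * ln 8)"
      using lnn by (subst ln_le_cancel_iff) auto
    also have "\<dots> = real ?g * ln 2 + ln (ln 8)"
      by (subst ln_mult) (auto simp: ln_realpow)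
    finally show ?thesis using ln2 by (simp add: field_simps)
  qed
  \<comment> \<open>This is the binary logarithm of the binary logarithm of
    \<open>n\<close>.\<close>
  let ?y = "(ln (ln (real n)) - ln (ln 2)) / ln 2"
  show "real ?g \<le> 19 * ?y + 56"
  proof -
    \<comment> \<open>The added 1 ensures \<open>1 \<le> k\<close>. Rounding gives
      \<open>k \<le> ?y + 2\<close>, whence \<open>56 = 19 * 2 + 18\<close>.\<close>
    define k where "k = nat \<lceil>?y\<rceil> + 1"
    have "ln 2 \<le> ln (real n)" using n by (subst ln_le_cancel_iff) auto
    then have y0: "0 \<le> ?y"
      using lnn ln2 by (intro divide_nonneg_pos) auto
    then have k: "?y \<le> real k" "real k \<le> ?y + 2"
      unfolding k_def by linarith+
    have "ln (ln (real n)) \<le> real k * ln 2 + ln (ln 2)"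
      using k(1) ln2 by (simp add: field_simps)
    also have "\<dots> = ln (2 ^ k * ln 2)"
      by (subst ln_mult) (auto simp: ln_realpow)
    finally have "ln (real n) \<le> 2 ^ k * ln 2"
      using lnn by (subst (asm) ln_le_cancel_iff) auto
    also have "\<dots> = ln (2 ^ 2 ^ k)"
      by (subst ln_realpow) auto
    finally have "real n \<le> 2 ^ 2 ^ k"
      using n by (subst (asm) ln_le_cancel_iff) auto
    then have "real n \<le> real (2 ^ 2 ^ k)" by simp
    then have "n \<le> 2 ^ 2 ^ k" by (simp only: of_nat_le_iff)
    then have "?g \<le> 18 * (k + 1) + k"
      by (intro game_length_le) (simp add: k_def)
    then have "real ?g \<le> real (18 * (k + 1) + k)" by (rule of_nat_mono)
    then have "real ?g \<le> 19 * real k + 18" by simp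
    then show ?thesis using k(2) by linarith
  qed
qed

theorem theorem1:
  "\<exists>c C :: real. \<exists>n0 :: nat. c > 0 \<and> C > 0 \<and> n0 \<ge> 2 \<and>
     (\<forall>n\<ge>n0. c * ln (ln (real n)) \<le> real (game_length n) \<and>
             real (game_length n) \<le> C * ln (ln (real n)))"
proof -
  have "filterlim (\<lambda>n. ln (ln (real n))) at_top sequentially"
    by (intro filterlim_compose[OF ln_at_top] filterlim_real_sequentially)
  \<comment> \<open>The three thresholds respectively absorb \<open>ln (ln 8)\<close> into half of
    the main term, the constant 56 into a multiple of it, and the positive number
    \<open>- ln (ln 2)\<close> into its double.\<close>
  then have "eventually (\<lambda>n. max (2 * ln (ln 8)) (max 1 (- ln (ln 2))) \<le> ln (ln (real n))) sequentially"
    unfolding filterlim_at_top by blast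
  then obtain n1 where n1:
    "\<And>n. n \<ge> n1 \<Longrightarrow> max (2 * ln (ln 8)) (max 1 (- ln (ln 2))) \<le> ln (ln (real n))"
    by (auto simp: eventually_sequentially)
  have ln2: "0 < ln (2 :: real)" by simp
  show ?thesis
  proof (intro exI conjI allI impI)
    show "0 < 1 / (2 * ln (2 :: real))" "0 < 38 / ln 2 + (56 :: real)"
      using ln2 by (auto intro: add_pos_pos)
    show "2 \<le> max 3 n1" by simp
  next
    fix n assume n: "max 3 n1 \<le> n"
    define y where "y = ln (ln (real n))"
    have y: "2 * ln (ln 8) \<le> y" "1 \<le> y" "- ln (ln 2) \<le> y"
      using n1[of n] n by (auto simp: y_def)
    have "1 / (2 * ln 2) * y = (y / 2) / ln 2" by simp
    also have "\<dots> \<le> (y - ln (ln 8)) / ln 2"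
      using y ln2 by (intro divide_right_mono) auto
    also have "\<dots> \<le> real (game_length n)"
      using loglog_bounds(1)[of n] n by (simp add: y_def)
    finally show "1 / (2 * ln 2) * ln (ln (real n)) \<le> real (game_length n)"
      by (simp add: y_def)
    have "real (game_length n) \<le> 19 * ((y - ln (ln 2)) / ln 2) + 56"
      using loglog_bounds(2)[of n] n by (simp add: y_def)
    also have "\<dots> \<le> 19 * ((2 * y) / ln 2) + 56 * y"
      using y ln2 by (intro add_mono mult_left_mono divide_right_mono) auto
    also have "\<dots> = (38 / ln 2 + 56) * y" by (simp add: algebra_simps)
    finally show "real (game_length n) \<le> (38 / ln 2 + 56) * ln (ln (real n))"
      by (simp add: y_def)
  qed
qed

end
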